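(* Let $l\geqslant 1$ and let $\Delta^+$ be the set of positive roots of $\mathfrak{sl}_{l+1}(\mathbb C)$. For every integer $r$ with $0\leqslant r\leqslant l$, the number of elements $\Phi\in\mathcal F_\emptyset$ such that $\sharp I_\Phi=r$ is $$\binom{l}{r}\sum_{k=0}^{\lfloor (l-r)/2\rfloor}\binom{l-r}{2k}\,\mathcal C_k,$$ where $\mathcal C_k$ denotes the $k$-th Catalan number.
   Context: The root system of $\mathfrak{sl}_{l+1}(\mathbb C)$ is $\Delta=\{\epsilon_i-\epsilon_j: 1\leqslant i,j\leqslant l+1, i\neq j\}$, with positive roots $\Delta^+=\{\epsilon_i-\epsilon_j: 1\leqslant i<j\leqslant l+1\}$ and simple roots $\Pi=\{\alpha_1,\dots,\alpha_l\}$, $\alpha_i=\epsilon_i-\epsilon_{i+1}$. For $I\subset\Pi$, $\Delta_I=\mathbb Z I\cap\Delta$ and $$\mathcal F_I=\{\Phi\subset\Delta^+\setminus\Delta_I:\ \text{if }\alpha\in\Phi,\ \beta\in\Delta^+\cup\Delta_I,\ \alpha+\beta\in\Delta^+,\text{ then }\alpha+\beta\in\Phi\}.$$ (The elements of $\mathcal F_I$ correspond bijectively to the ad-nilpotent ideals of the standard parabolic subalgebra $\mathfrak p_I$ via $\Phi\mapsto\bigoplus_{\alpha\in\Phi}\mathfrak g_\alpha$.) For $\Phi\in\mathcal F_\emptyset$, $I_\Phi=\{\alpha\in\Pi:\Phi\in\mathcal F_{\{\alpha\}}\}$, which is the maximal element of $\{I\subset\Pi:\Phi\in\mathcal F_I\}$.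 The Catalan numbers are $\mathcal C_k=\frac{1}{k+1}\binom{2k}{k}$. *)

theory Defs
  imports Complex_Main "HOL-Library.Function_Algebras"
begin

text \<open>
  Weights are integer coordinate vectors with coordinates \<open>1, \<dots>, l + 1\<close>, encoded as functions
  \<open>nat \<Rightarrow> int\<close> with the pointwise group structure. On trace-free diagonal matrices the
  functionals \<open>\<epsilon>\<^sub>i\<close> satisfy \<open>\<epsilon>\<^sub>1 + \<dots> + \<epsilon>\<^bsub>l+1\<^esub> = 0\<close>, whereas the coordinate vectors are independent;
  the root lattice is the same in both models, since it meets the line spanned by that sum only in 0.
\<close>

type_synonym weight = "nat \<Rightarrow> int"

definition eps :: "nat \<Rightarrow> weight" where
  "eps i = (\<lambda>k. if k = i then 1 else 0)"

definition roots :: "nat \<Rightarrow> weight set" where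
  "roots l = {eps i - eps j | i j. 1 \<le> i \<and> i \<le> l + 1 \<and> 1 \<le> j \<and> j \<le> l + 1 \<and> i \<noteq> j}"

definition pos_roots :: "nat \<Rightarrow> weight set" where
  "pos_roots l = {eps i - eps j | i j. 1 \<le> i \<and> i < j \<and> j \<le> l + 1}"

definition simple_roots :: "nat \<Rightarrow> weight set" where
  "simple_roots l = {eps i - eps (i + 1) | i. 1 \<le> i \<and> i \<le> l}"

text \<open>
  The integer span \<open>\<int>I\<close>, as the set of integer combinations of all elements of \<open>I\<close>; correct only
  for finite \<open>I\<close> (it is used for sets of simple roots).
\<close>

definition int_span :: "weight set \<Rightarrow> weight set" where
  "int_span I = {\<Sum>\<alpha>\<in>I. (\<lambda>k. c \<alpha> * \<alpha> k) | c :: weight \<Rightarrow> int. True}"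

definition levi_roots :: "nat \<Rightarrow> weight set \<Rightarrow> weight set" where
  "levi_roots l I = int_span I \<inter> roots l"

text \<open>The family \<open>\<F>\<^sub>I\<close>, intended for \<open>I \<subseteq> simple_roots l\<close>.\<close>

definition ad_nilpotent_sets :: "nat \<Rightarrow> weight set \<Rightarrow> weight set set" where
  "ad_nilpotent_sets l I =
     {\<Phi>. \<Phi> \<subseteq> pos_roots l - levi_roots l I \<and>
          (\<forall>\<alpha>\<in>\<Phi>. \<forall>\<beta>\<in>pos_roots l \<union> levi_roots l I.
             \<alpha> + \<beta> \<in> pos_roots l \<longrightarrow> \<alpha> + \<beta> \<in> \<Phi>)}"

definition max_parabolic :: "nat \<Rightarrow> weight set \<Rightarrow> weight set" where
  "max_parabolic l \<Phi> = {\<alpha> \<in> simple_roots l. \<Phi> \<in> ad_nilpotent_sets l {\<alpha>}}"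

definition catalan :: "nat \<Rightarrow> real" where
  "catalan k = 1 / (real k + 1) * real ((2 * k) choose k)"

end

theory Submission
  imports Defs
begin

text \<open>
  An element \<open>\<Phi>\<close> of \<open>\<F>\<^sub>\<emptyset>\<close> is the same as a set \<open>P\<close> of pairs \<open>(i, j)\<close> with \<open>1 \<le> i < j \<le> l + 1\<close> (for the
  roots \<open>\<epsilon>\<^sub>i - \<epsilon>\<^sub>j\<close>) that is closed under decreasing \<open>i\<close> and increasing \<open>j\<close>. Such a set is
  determined by its corners, the minimal roots of \<open>\<Phi>\<close>. They form a chain in which row and column
  increase together, so only the set \<open>A\<close> of rows and the set \<open>B\<close> of columns, the latter shifted down
  by 1, have to be remembered: the corner in the \<open>s\<close>-th row of \<open>A\<close> sits in the \<open>s\<close>-th column of \<open>B\<close>.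
  Both are subsets of \<open>{1..l}\<close>, and the condition \<open>i < j\<close> on corners says exactly that every initial
  segment of \<open>{1..l}\<close> contains at least as many elements of \<open>A\<close> as of \<open>B\<close>
  (\<open>bij_betw_corners\<close>).

  The simple root \<open>\<alpha>\<^sub>i\<close> lies in \<open>I\<^sub>\<Phi>\<close> iff subtracting \<open>\<alpha>\<^sub>i\<close> never leads out of \<open>\<Phi>\<close>. Subtracting
  \<open>\<alpha>\<^sub>i\<close> moves a pair from row \<open>i\<close> to row \<open>i + 1\<close> or from column \<open>i + 1\<close> to column \<open>i\<close>, and this
  leaves \<open>P\<close> somewhere iff \<open>i\<close> is the row of a corner, or \<open>i + 1\<close> the column of one. Hence \<open>I\<^sub>\<Phi>\<close>
  corresponds to \<open>{1..l} - (A \<union> B)\<close> (\<open>card_max_parabolic\<close>).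

  It remains to count the pairs \<open>(A, B)\<close> for which this complement has \<open>r\<close> elements. Read \<open>{1..l}\<close> from
  left to right as a path: up at elements of \<open>A\<close> only, down at elements of \<open>B\<close> only, flat at the
  others. The path ends at height 0 and stays nonnegative. Its \<open>r\<close> flat steps outside \<open>A \<union> B\<close> can be
  at any \<open>r\<close> of the \<open>l\<close> positions, and removing them leaves an arbitrary Motzkin path of length
  \<open>l - r\<close>; choosing the \<open>2 k\<close> positions of its up and down steps leaves a Dyck path, and there are
  \<open>\<C>\<^sub>k\<close> of these.
\<close>

section \<open>Counting ballot pairs\<close>

text \<open>
  The pairs \<open>(A, B)\<close>, seen as paths with an up step at each element of \<open>A - B\<close>, a down step at each
  element of \<open>B - A\<close> and flat steps of two kinds, in \<open>A \<inter> B\<close> and outside \<open>A \<union> B\<close>. The parameter \<open>h\<close> is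
  the final height and \<open>r\<close> the number of flat steps of the second kind. Corners of up-sets give
  \<open>h = 0\<close>; a general \<open>h\<close> is what makes a recursion on the last step possible.
\<close>

definition ballot_pairs :: "nat \<Rightarrow> nat \<Rightarrow> nat \<Rightarrow> (nat set \<times> nat set) set" where
  "ballot_pairs l h r =
     {(A, B). A \<subseteq> {1..l} \<and> B \<subseteq> {1..l} \<and>
        (\<forall>m. card (B \<inter> {..<m}) \<le> card (A \<inter> {..<m})) \<and> card A = card B + h \<and>
        card ({1..l} - (A \<union> B)) = r}"

lemma finite_ballot_pairs [simp]: "finite (ballot_pairs l h r)"
  by (rule finite_subset[of _ "Pow {1..l} \<times> Pow {1..l}"]) (auto simp: ballot_pairs_def)

text \<open>
  A path stays nonnegative iff it does so before its last step and also ends at a nonnegative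
  height.
\<close>

lemma ballot_prefixes_iff:
  fixes A B A' B' :: "nat set"
  assumes "A \<subseteq> {1..l}" "B \<subseteq> {1..l}" "A' - {Suc l} = A" "B' - {Suc l} = B"
    and "A' \<subseteq> {1..Suc l}" "B' \<subseteq> {1..Suc l}"
  shows "(\<forall>m. card (B' \<inter> {..<m}) \<le> card (A' \<inter> {..<m})) \<longleftrightarrow>
    (\<forall>m. card (B \<inter> {..<m}) \<le> card (A \<inter> {..<m})) \<and> card B' \<le> card A'"
proof -
  have low: "B' \<inter> {..<m} = B \<inter> {..<m}" "A' \<inter> {..<m} = A \<inter> {..<m}" if "m \<le> Suc l" for m
    using assms that by auto
  have high: "B' \<inter> {..<m} = B'" "A' \<inter> {..<m} = A'" if "Suc l < m" for m
    using assms that by force+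
  have cap: "B \<inter> {..<m} = B \<inter> {..<Suc l}" "A \<inter> {..<m} = A \<inter> {..<Suc l}" if "Suc l < m" for m
    using assms that by force+
  show ?thesis
  proof (intro iffI conjI allI)
    fix m assume *: "\<forall>m. card (B' \<inter> {..<m}) \<le> card (A' \<inter> {..<m})"
    show "card (B \<inter> {..<m}) \<le> card (A \<inter> {..<m})"
    proof (cases "m \<le> Suc l")
      case True
      then show ?thesis using * low by metis
    next
      case False
      then show ?thesis using *[rule_format, of "Suc l"] low[of "Suc l"] cap[of m] by simp
    qed
  next
    assume *: "\<forall>m. card (B' \<inter> {..<m}) \<le> card (A' \<inter> {..<m})"
    show "card B' \<le> card A'"
      using *[rule_format, of "Suc (Suc l)"] high[of "Suc (Suc l)"] by simp
  next
    fix m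
    assume *: "(\<forall>m. card (B \<inter> {..<m}) \<le> card (A \<inter> {..<m})) \<and> card B' \<le> card A'"
    show "card (B' \<inter> {..<m}) \<le> card (A' \<inter> {..<m})"
      by (cases "m \<le> Suc l") (use * low[of m] high[of m] in auto)
  qed
qed

text \<open>
  A last step that ends at height \<open>h \<ge> 0\<close> cannot make the path negative, so for each of the four kinds of
  step only the final height and the number of flat steps outside \<open>A \<union> B\<close> have to be adjusted.
\<close>

lemma ballot_pairs_last_step:
  assumes A: "A \<subseteq> {1..l}" and B: "B \<subseteq> {1..l}"
  shows "(A, B) \<in> ballot_pairs (Suc l) h r \<longleftrightarrow> r > 0 \<and> (A, B) \<in> ballot_pairs l h (r - 1)"
    and "(insert (Suc l) A, insert (Suc l) B) \<in> ballot_pairs (Suc l) h r \<longleftrightarrow>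
           (A, B) \<in> ballot_pairs l h r"
    and "(A, insert (Suc l) B) \<in> ballot_pairs (Suc l) h r \<longleftrightarrow> (A, B) \<in> ballot_pairs l (Suc h) r"
    and "(insert (Suc l) A, B) \<in> ballot_pairs (Suc l) h r \<longleftrightarrow>
           h > 0 \<and> (A, B) \<in> ballot_pairs l (h - 1) r"
proof -
  have fin: "finite A" "finite B" using assms finite_subset by blast+
  have new: "Suc l \<notin> A" "Suc l \<notin> B" using assms by auto
  have sub: "A \<subseteq> {1..Suc l}" "B \<subseteq> {1..Suc l}" using assms by auto
  have ex: "{1..Suc l} - (A \<union> B) = insert (Suc l) ({1..l} - (A \<union> B))"
    "{1..Suc l} - (insert (Suc l) A \<union> insert (Suc l) B) = {1..l} - (A \<union> B)"
    "{1..Suc l} - (A \<union> insert (Suc l) B) = {1..l} - (A \<union> B)"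
    "{1..Suc l} - (insert (Suc l) A \<union> B) = {1..l} - (A \<union> B)"
    using new by (auto simp: le_Suc_eq)
  have c: "card (insert (Suc l) ({1..l} - (A \<union> B))) = Suc (card ({1..l} - (A \<union> B)))"
    by simp
  note pre = ballot_prefixes_iff[OF A B]
  have p: "(\<forall>m. card (B \<inter> {..<m}) \<le> card (A \<inter> {..<m})) \<Longrightarrow> card B \<le> card A"
    using pre[of A B] new sub by auto
  show "(A, B) \<in> ballot_pairs (Suc l) h r \<longleftrightarrow> r > 0 \<and> (A, B) \<in> ballot_pairs l h (r - 1)"
    unfolding ballot_pairs_def mem_Collect_eq prod.case ex c using A B sub by auto
  show "(insert (Suc l) A, insert (Suc l) B) \<in> ballot_pairs (Suc l) h r \<longleftrightarrow>
           (A, B) \<in> ballot_pairs l h r"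
    unfolding ballot_pairs_def mem_Collect_eq prod.case ex
    using A B new fin sub pre[of "insert (Suc l) A" "insert (Suc l) B"] p by auto
  show "(A, insert (Suc l) B) \<in> ballot_pairs (Suc l) h r \<longleftrightarrow> (A, B) \<in> ballot_pairs l (Suc h) r"
    unfolding ballot_pairs_def mem_Collect_eq prod.case ex
    using A B new fin sub pre[of A "insert (Suc l) B"] by auto
  show "(insert (Suc l) A, B) \<in> ballot_pairs (Suc l) h r \<longleftrightarrow>
           h > 0 \<and> (A, B) \<in> ballot_pairs l (h - 1) r"
    unfolding ballot_pairs_def mem_Collect_eq prod.case ex
    using A B new fin sub pre[of "insert (Suc l) A" B] p by auto
qed

lemma card_ballot_pairs_Suc:
  "card (ballot_pairs (Suc l) h r) =
     (if r = 0 then 0 else card (ballot_pairs l h (r - 1))) + card (ballot_pairs l h r) +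
     card (ballot_pairs l (Suc h) r) + (if h = 0 then 0 else card (ballot_pairs l (h - 1) r))"
proof -
  let ?n = "Suc l"
  define W1 where "W1 = (if r = 0 then {} else ballot_pairs l h (r - 1))"
  define W2 where "W2 = map_prod (insert ?n) (insert ?n) ` ballot_pairs l h r"
  define W3 where "W3 = map_prod id (insert ?n) ` ballot_pairs l (Suc h) r"
  define W4 where "W4 = (if h = 0 then {} else map_prod (insert ?n) id ` ballot_pairs l (h - 1) r)"
  note W = W1_def W2_def W3_def W4_def
  have bounded: "A \<subseteq> {1..l}" "B \<subseteq> {1..l}" "?n \<notin> A" "?n \<notin> B"
    if "(A, B) \<in> ballot_pairs l k s" for A B k s
    using that by (auto simp: ballot_pairs_def)
  have fin: "finite W1" "finite W2" "finite W3" "finite W4"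
    by (simp_all add: W)
  have disj: "W1 \<inter> W2 = {}" "(W1 \<union> W2) \<inter> W3 = {}" "(W1 \<union> W2 \<union> W3) \<inter> W4 = {}"
    unfolding W by (auto dest: bounded split: if_splits)
  have inj: "inj_on (map_prod f g) (ballot_pairs l k s)"
    if "f = insert ?n \<or> f = id" "g = insert ?n \<or> g = id" for f g k s
  proof (rule inj_onI, clarsimp)
    fix A B A' B'
    assume mem: "(A, B) \<in> ballot_pairs l k s" "(A', B') \<in> ballot_pairs l k s"
      and eq: "f A = f A'" "g B = g B'"
    show "A = A' \<and> B = B'"
      using that eq bounded(3,4)[OF mem(1)] bounded(3,4)[OF mem(2)] by (metis id_apply insert_ident)
  qed
  have "ballot_pairs ?n h r = W1 \<union> W2 \<union> W3 \<union> W4"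
  proof (intro equalityI subsetI)
    fix x assume x: "x \<in> ballot_pairs ?n h r"
    obtain A B where xe: "x = (A, B)" by force
    define A0 B0 where "A0 = A - {?n}" and "B0 = B - {?n}"
    have sub: "A0 \<subseteq> {1..l}" "B0 \<subseteq> {1..l}"
      using x by (auto simp: xe A0_def B0_def ballot_pairs_def le_Suc_eq)
    have A: "A = A0 \<or> A = insert ?n A0" and B: "B = B0 \<or> B = insert ?n B0"
      by (auto simp: A0_def B0_def)
    note last = ballot_pairs_last_step[OF sub, of h r]
    consider "A = A0" "B = B0" | "A = insert ?n A0" "B = insert ?n B0"
      | "A = A0" "B = insert ?n B0" | "A = insert ?n A0" "B = B0"
      using A B by blast
    then show "x \<in> W1 \<union> W2 \<union> W3 \<union> W4"
    proof cases
      case 1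
      then have "x \<in> W1" using x last(1) by (simp add: xe W)
      then show ?thesis by simp
    next
      case 2
      then have "x \<in> W2" using x last(2) by (force simp: xe W)
      then show ?thesis by simp
    next
      case 3
      then have "x \<in> W3" using x last(3) by (force simp: xe W)
      then show ?thesis by simp
    next
      case 4
      then have "x \<in> W4" using x last(4) by (force simp: xe W)
      then show ?thesis by simp
    qed
  next
    fix x assume "x \<in> W1 \<union> W2 \<union> W3 \<union> W4"
    then show "x \<in> ballot_pairs ?n h r"
      unfolding W
      by (cases x) (auto simp: ballot_pairs_last_step[OF bounded(1,2)] split: if_splits)
  qed
  then have "card (ballot_pairs ?n h r) = card W1 + card W2 + card W3 + card W4"
    using fin disj by (simp add: card_Un_disjoint)
  moreover have "card W2 = card (ballot_pairs l h r)" "card W3 = card (ballot_pairs l (Suc h) r)"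
    "card W4 = (if h = 0 then 0 else card (ballot_pairs l (h - 1) r))"
    unfolding W using inj by (simp_all add: card_image)
  ultimately show ?thesis by (simp add: W1_def)
qed

text \<open>
  The number of walks with \<open>j\<close> steps \<open>\<plusminus>1\<close> from height 0 to height \<open>h\<close> that never become negative.
\<close>

fun dyck :: "nat \<Rightarrow> nat \<Rightarrow> nat" where
  "dyck 0 h = (if h = 0 then 1 else 0)"
| "dyck (Suc j) 0 = dyck j 1"
| "dyck (Suc j) (Suc h) = dyck j h + dyck j (Suc (Suc h))"

text \<open>
  The number of nonnegative walks with \<open>m\<close> steps in \<open>{-1, 0, 1}\<close> from height 0 to height \<open>h\<close>, grouped
  by the number \<open>j\<close> of nonzero steps, whose times can be chosen in \<open>m choose j\<close> ways.
\<close>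

definition motzkin :: "nat \<Rightarrow> nat \<Rightarrow> nat" where
  "motzkin m h = (\<Sum>j\<le>m. (m choose j) * dyck j h)"

lemma motzkin_Suc:
  "motzkin (Suc m) h =
     motzkin m h + motzkin m (Suc h) + (if h = 0 then 0 else motzkin m (h - 1))"
proof -
  have "motzkin (Suc m) h = dyck 0 h + (\<Sum>j\<le>m. (Suc m choose Suc j) * dyck (Suc j) h)"
    unfolding motzkin_def by (subst sum.atMost_Suc_shift) simp
  also have "\<dots> = (dyck 0 h + (\<Sum>j\<le>m. (m choose Suc j) * dyck (Suc j) h)) +
      (\<Sum>j\<le>m. (m choose j) * dyck (Suc j) h)"
    by (simp add: sum.distrib algebra_simps)
  also have "dyck 0 h + (\<Sum>j\<le>m. (m choose Suc j) * dyck (Suc j) h) =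
      (\<Sum>j\<le>Suc m. (m choose j) * dyck j h)"
    by (subst sum.atMost_Suc_shift) simp
  also have "\<dots> = motzkin m h"
    by (simp add: motzkin_def)
  also have "(\<Sum>j\<le>m. (m choose j) * dyck (Suc j) h) =
      motzkin m (Suc h) + (if h = 0 then 0 else motzkin m (h - 1))"
    by (cases h) (simp_all add: motzkin_def sum.distrib algebra_simps)
  finally show ?thesis by simp
qed

text \<open>
  The positions outside \<open>A \<union> B\<close> have no influence on the rest of the path, so they can be chosen freely.
  In the induction this independence is Pascal's rule for \<open>l choose r\<close>: the last position either is
  one of these positions, or is the last step of the Motzkin path.
\<close>

lemma card_ballot_pairs: "card (ballot_pairs l h r) = (l choose r) * motzkin (l - r) h"
proof (induction l arbitrary: h r)
  case 0
  have "ballot_pairs 0 h r = (if h = 0 \<and> r = 0 then {({}, {})} else {})"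
    by (auto simp: ballot_pairs_def)
  then show ?case by (simp add: motzkin_def)
next
  case (Suc l)
  \<comment> \<open>For \<open>r > l\<close> both sides vanish, although \<open>Suc l - r\<close> is truncated.\<close>
  have stay: "(l choose r) * motzkin (Suc l - r) h = (l choose r) *
      (motzkin (l - r) h + motzkin (l - r) (Suc h) + (if h = 0 then 0 else motzkin (l - r) (h - 1)))"
    by (cases "r \<le> l") (simp_all add: Suc_diff_le motzkin_Suc)
  have "(Suc l choose r) * motzkin (Suc l - r) h =
      (if r = 0 then 0 else (l choose (r - 1)) * motzkin (l - (r - 1)) h) +
      (l choose r) * motzkin (Suc l - r) h"
    by (cases r) (simp_all add: algebra_simps)
  then show ?case
    unfolding card_ballot_pairs_Suc Suc.IH stay by (simp add: algebra_simps)
qed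

lemma dyck_odd: "odd (j + h) \<Longrightarrow> dyck j h = 0"
  by (induction j h rule: dyck.induct) (auto simp: odd_pos)

lemma dyck_high: "j < h \<Longrightarrow> dyck j h = 0"
  by (induction j h rule: dyck.induct) auto

text \<open>
  The reflection principle. There are \<open>(2 k + h) choose k\<close> unrestricted walks of length \<open>2 k + h\<close> to
  height \<open>h\<close>. Reflecting a walk after its first visit to \<open>-1\<close> matches those that become negative with
  the walks to \<open>-h - 2\<close>, which have \<open>k + h + 1\<close> down steps. The induction uses only that both
  binomial coefficients satisfy Pascal's rule and that they coincide at the boundary \<open>h = -1\<close>, where
  the number of nonnegative walks is 0.
\<close>

lemma dyck_reflection:
  "dyck (2 * k + h) h + ((2 * k + h) choose (k + h + 1)) = (2 * k + h) choose k"
proof (induction "2 * k + h" arbitrary: k h)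
  case 0
  then show ?case by simp
next
  case (Suc j)
  show ?case
  proof (cases h)
    case 0
    with Suc.hyps obtain k' where k: "k = Suc k'" by (cases k) auto
    have j: "j = 2 * k' + 1" using Suc.hyps(2) 0 k by simp
    have "dyck j 1 + (j choose Suc (Suc k')) = j choose k'"
      using Suc.hyps(1)[of k' 1] by (simp add: j del: dyck.simps binomial_Suc_Suc)
    then show ?thesis
      unfolding Suc.hyps(2)[symmetric] by (simp add: 0 k)
  next
    case h: (Suc h')
    show ?thesis
    proof (cases k)
      case 0
      then show ?thesis
        using Suc.hyps(1)[of 0 h'] Suc.hyps(2) h by (simp add: dyck_high binomial_eq_0)
    next
      case k: (Suc k')
      have j: "j = 2 * k + h'" "j = 2 * k' + Suc (Suc h')" using Suc.hyps(2) h k by auto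
      have "dyck j h' + (j choose Suc (Suc (k' + h'))) = j choose Suc k'"
        using Suc.hyps(1)[OF j(1)] unfolding j(1)[symmetric] by (simp add: k)
      moreover have "dyck j (Suc (Suc h')) + (j choose Suc (Suc (Suc (k' + h')))) = j choose k'"
        using Suc.hyps(1)[OF j(2)] unfolding j(2)[symmetric] by simp
      ultimately show ?thesis
        unfolding Suc.hyps(2)[symmetric] by (simp add: h k)
    qed
  qed
qed

lemma dyck_eq_catalan: "real (dyck (2 * k) 0) = catalan k"
proof -
  have "Suc k * (2 * k choose Suc k) = k * (2 * k choose k)"
    by (metis (no_types, lifting) binomial_absorption binomial_absorb_comp add_diff_cancel_left' mult_2)
  then have "real (Suc k) * real (2 * k choose Suc k) = real k * real (2 * k choose k)"
    by (metis of_nat_mult)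
  moreover have "real (dyck (2 * k) 0) + real (2 * k choose Suc k) = real (2 * k choose k)"
    using dyck_reflection[of k 0] by (simp flip: of_nat_add)
  ultimately have "real (Suc k) * real (dyck (2 * k) 0) = real (2 * k choose k)"
    by (simp add: algebra_simps) (smt (verit) distrib_left)
  then show ?thesis by (simp add: catalan_def field_simps)
qed

lemma motzkin_eq_sum_catalan:
  "real (motzkin m 0) = (\<Sum>k = 0..m div 2. real (m choose (2 * k)) * catalan k)"
proof -
  have "real (motzkin m 0) = (\<Sum>j\<le>m. real ((m choose j) * dyck j 0))"
    by (simp add: motzkin_def)
  also have "\<dots> = (\<Sum>j\<in>(*) 2 ` {0..m div 2}. real ((m choose j) * dyck j 0))"
  proof (rule sum.mono_neutral_right)
    show "\<forall>j\<in>{..m} - (*) 2 ` {0..m div 2}. real ((m choose j) * dyck j 0) = 0"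
    proof
      fix j assume j: "j \<in> {..m} - (*) 2 ` {0..m div 2}"
      have "odd j"
        using j by (force elim!: evenE)
      then show "real ((m choose j) * dyck j 0) = 0" by (simp add: dyck_odd)
    qed
  qed auto
  also have "\<dots> = (\<Sum>k = 0..m div 2. real ((m choose (2 * k)) * dyck (2 * k) 0))"
    by (subst sum.reindex) (auto simp: inj_on_def)
  finally show ?thesis by (simp add: dyck_eq_catalan)
qed

section \<open>Corners of an up-set\<close>

text \<open>
  Here \<open>(i, j)\<close> stands for the positive root \<open>\<epsilon>\<^sub>i - \<epsilon>\<^sub>j\<close>; the second condition is closure upwards in the
  root order.
\<close>

definition up_sets :: "nat \<Rightarrow> (nat \<times> nat) set set" where
  "up_sets l =
     {P. (\<forall>i j. (i, j) \<in> P \<longrightarrow> 1 \<le> i \<and> i < j \<and> j \<le> l + 1) \<and>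
         (\<forall>i j i' j'. (i, j) \<in> P \<longrightarrow> 1 \<le> i' \<longrightarrow> i' \<le> i \<longrightarrow> j \<le> j' \<longrightarrow> j' \<le> l + 1 \<longrightarrow> (i', j') \<in> P)}"

text \<open>
  A corner \<open>i\<close>, \<open>j\<close> is the minimal element \<open>(i, j + 1)\<close> of \<open>P\<close>. With this shift, rows and columns of corners
  range over the same set \<open>{1..l}\<close> of indices of simple roots.
\<close>

definition corner :: "(nat \<times> nat) set \<Rightarrow> nat \<Rightarrow> nat \<Rightarrow> bool" where
  "corner P i j \<longleftrightarrow> (i, Suc j) \<in> P \<and> (Suc i, Suc j) \<notin> P \<and> (i, j) \<notin> P"

definition corner_rows :: "(nat \<times> nat) set \<Rightarrow> nat set" where
  "corner_rows P = {i. \<exists>j. corner P i j}"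

definition corner_cols :: "(nat \<times> nat) set \<Rightarrow> nat set" where
  "corner_cols P = {j. \<exists>i. corner P i j}"

text \<open>
  The up-set whose corners match the elements of \<open>A\<close> and \<open>B\<close> of equal rank. The pair \<open>(i, j)\<close> should
  belong to it iff some corner has row at least \<open>i\<close> and column at most \<open>j\<close>. The corner of least row
  at least \<open>i\<close> has rank one more than the number of elements of \<open>A\<close> below \<open>i\<close>, so the condition is that
  \<open>B\<close> has more elements below \<open>j\<close> than \<open>A\<close> has below \<open>i\<close>.
\<close>

definition region :: "nat \<Rightarrow> nat set \<Rightarrow> nat set \<Rightarrow> (nat \<times> nat) set" where
  "region l A B = {(i, j). 1 \<le> i \<and> j \<le> l + 1 \<and> card (A \<inter> {..<i}) < card (B \<inter> {..<j})}"

lemma up_sets_bounds: "P \<in> up_sets l \<Longrightarrow> (i, j) \<in> P \<Longrightarrow> 1 \<le> i \<and> i < j \<and> j \<le> l + 1"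
  unfolding up_sets_def mem_Collect_eq by (drule conjunct1) blast

lemma up_sets_up:
  assumes "P \<in> up_sets l" "(i, j) \<in> P" "1 \<le> i'" "i' \<le> i" "j \<le> j'" "j' \<le> l + 1"
  shows "(i', j') \<in> P"
proof -
  have "(i, j) \<in> P \<longrightarrow> 1 \<le> i' \<longrightarrow> i' \<le> i \<longrightarrow> j \<le> j' \<longrightarrow> j' \<le> l + 1 \<longrightarrow> (i', j') \<in> P"
    using assms(1) unfolding up_sets_def mem_Collect_eq by (elim conjE allE)
  then show ?thesis using assms(2-) by simp
qed

context
  fixes l :: nat and P :: "(nat \<times> nat) set"
  assumes P: "P \<in> up_sets l"
begin

lemma corner_bounds: "corner P i j \<Longrightarrow> 1 \<le> i \<and> i \<le> j \<and> j \<le> l"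
  using up_sets_bounds[OF P, of i "Suc j"] by (auto simp: corner_def)

text \<open>
  Two minimal elements of \<open>P\<close> are incomparable, so the one with the larger row also has the larger
  column.
\<close>

lemma corner_less_iff:
  assumes "corner P i j" "corner P i' j'"
  shows "i < i' \<longleftrightarrow> j < j'"
proof
  assume "i < i'"
  show "j < j'"
  proof (rule ccontr)
    assume "\<not> j < j'"
    then have "(Suc i, Suc j) \<in> P"
      using up_sets_up[OF P, of i' "Suc j'" "Suc i" "Suc j"] \<open>i < i'\<close> assms corner_bounds[OF assms(1)]
      by (auto simp: corner_def)
    then show False using assms by (simp add: corner_def)
  qed
next
  assume "j < j'"
  show "i < i'"
  proof (rule ccontr)
    assume "\<not> i < i'"
    then have "(i', j') \<in> P"
      using up_sets_up[OF P, of i "Suc j" i' j'] \<open>j < j'\<close> assms corner_bounds[OF assms(2)]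
      by (auto simp: corner_def)
    then show False using assms by (simp add: corner_def)
  qed
qed

lemma corner_unique:
  assumes "corner P i j" "corner P i' j'"
  shows "i = i' \<longleftrightarrow> j = j'"
  using corner_less_iff[OF assms] corner_less_iff[OF assms(2,1)] by linarith

lemma corner_below:
  assumes "(i, j) \<in> P"
  shows "\<exists>a b. corner P a b \<and> i \<le> a \<and> b < j"
  using assms
proof (induction "j - i" arbitrary: i j rule: less_induct)
  case less
  have b: "1 \<le> i" "i < j" "j \<le> l + 1" using up_sets_bounds[OF P less.prems] by auto
  consider "(Suc i, j) \<in> P" | "(i, j - 1) \<in> P" | "(Suc i, j) \<notin> P" "(i, j - 1) \<notin> P" by blast
  then show ?case
  proof cases
    case 1
    then show ?thesis using less.hyps[of j "Suc i"] b diff_less_mono2[of i "Suc i" j]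
      by (auto dest: Suc_leD)
  next
    case 2
    then obtain a b where "corner P a b" "i \<le> a" "b < j - 1"
      using less.hyps[of "j - 1" i] b 2 diff_less_mono[of "j - 1" j i] by auto
    then show ?thesis by (intro exI[of _ a] exI[of _ b]) auto
  next
    case 3
    then have "corner P i (j - 1)" using less.prems b by (simp add: corner_def)
    then show ?thesis using b by (intro exI[of _ i] exI[of _ "j - 1"]) auto
  qed
qed

lemma corner_rows_bound: "corner_rows P \<subseteq> {1..l}"
  and corner_cols_bound: "corner_cols P \<subseteq> {1..l}"
  using corner_bounds by (force simp: corner_rows_def corner_cols_def)+

lemma finite_corner_rows: "finite (corner_rows P)" and finite_corner_cols: "finite (corner_cols P)"
  by (rule finite_subset[OF corner_rows_bound], simp)
     (rule finite_subset[OF corner_cols_bound], simp)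

text \<open>
  Corners are a matching between their rows and their columns. Comparisons of numbers of rows and
  columns are reduced, here and in the next lemma, to implications for a single corner.
\<close>

lemma card_corner_cols_le:
  assumes "\<And>i j. corner P i j \<Longrightarrow> j \<in> T \<Longrightarrow> i \<in> S"
  shows "card (corner_cols P \<inter> T) \<le> card (corner_rows P \<inter> S)"
proof (rule card_le_if_inj_on_rel[where r = "\<lambda>j i. corner P i j"])
  show "finite (corner_rows P \<inter> S)" using finite_corner_rows by blast
  show "\<exists>i. i \<in> corner_rows P \<inter> S \<and> corner P i j" if "j \<in> corner_cols P \<inter> T" for j
    using that assms by (auto simp: corner_rows_def corner_cols_def)
qed (metis corner_unique)

lemma card_corner_rows_le:
  assumes "\<And>i j. corner P i j \<Longrightarrow> i \<in> S \<Longrightarrow> j \<in> T"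
  shows "card (corner_rows P \<inter> S) \<le> card (corner_cols P \<inter> T)"
proof (rule card_le_if_inj_on_rel[where r = "corner P"])
  show "finite (corner_cols P \<inter> T)" using finite_corner_cols by blast
  show "\<exists>j. j \<in> corner_cols P \<inter> T \<and> corner P i j" if "i \<in> corner_rows P \<inter> S" for i
    using that assms by (auto simp: corner_rows_def corner_cols_def)
qed (metis corner_unique)

lemma card_corner_rows_eq_cols: "card (corner_rows P) = card (corner_cols P)"
  using card_corner_rows_le[of UNIV UNIV] card_corner_cols_le[of UNIV UNIV] by simp

text \<open>
  Along the matching, a column below \<open>m\<close> goes to a row below \<open>m\<close>, because corners lie above the diagonal.
\<close>

lemma corner_ballot:
  "card (corner_cols P \<inter> {..<m}) \<le> card (corner_rows P \<inter> {..<m})"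
  by (rule card_corner_cols_le) (auto dest: corner_bounds)

text \<open>
  If \<open>(i, j)\<close> lies above a corner \<open>a\<close>, \<open>b\<close>, then the rows below \<open>i\<close> are matched with columns
  below \<open>b\<close>, and \<open>b\<close> itself is an additional column below \<open>j\<close>. If it lies above no corner, all columns below
  \<open>j\<close> are matched with rows below \<open>i\<close>.
\<close>

lemma region_corners: "region l (corner_rows P) (corner_cols P) = P"
proof -
  have "(i, j) \<in> region l (corner_rows P) (corner_cols P) \<longleftrightarrow> (i, j) \<in> P" for i j
  proof
    assume ij: "(i, j) \<in> P"
    obtain a b where ab: "corner P a b" "i \<le> a" "b < j" using corner_below[OF ij] by blast
    have "card (corner_rows P \<inter> {..<i}) \<le> card (corner_cols P \<inter> {..<b})"
      by (rule card_corner_rows_le) (use ab corner_less_iff[OF _ ab(1)] in force)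
    also have "\<dots> < card (corner_cols P \<inter> {..<j})"
    proof (rule psubset_card_mono)
      show "finite (corner_cols P \<inter> {..<j})" using finite_corner_cols by blast
      have "b \<in> corner_cols P" using ab by (auto simp: corner_cols_def)
      then show "corner_cols P \<inter> {..<b} \<subset> corner_cols P \<inter> {..<j}" using ab(3) by force
    qed
    finally show "(i, j) \<in> region l (corner_rows P) (corner_cols P)"
      using up_sets_bounds[OF P ij] by (simp add: region_def)
  next
    assume ij: "(i, j) \<in> region l (corner_rows P) (corner_cols P)"
    have "\<not> card (corner_cols P \<inter> {..<j}) \<le> card (corner_rows P \<inter> {..<i})"
      using ij by (simp add: region_def)
    then obtain a b where ab: "corner P a b" "b < j" "i \<le> a"
      using card_corner_cols_le[of "{..<j}" "{..<i}"] by force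
    then show "(i, j) \<in> P"
      using up_sets_up[OF P, of a "Suc b" i j] ij by (auto simp: corner_def region_def)
  qed
  then show ?thesis by auto
qed

text \<open>
  For \<open>i \<ge> 1\<close>, row \<open>i + 1\<close> of \<open>P\<close> is contained in row \<open>i\<close>; the containment is proper precisely at
  rows of corners, since a corner below \<open>(i, j)\<close> in a later row would put \<open>(i + 1, j)\<close> into \<open>P\<close>.
\<close>

lemma row_step_iff: "(\<exists>j. (i, j) \<in> P \<and> (Suc i, j) \<notin> P) \<longleftrightarrow> i \<in> corner_rows P"
proof
  assume "\<exists>j. (i, j) \<in> P \<and> (Suc i, j) \<notin> P"
  then obtain j where j: "(i, j) \<in> P" "(Suc i, j) \<notin> P" by blast
  obtain a b where ab: "corner P a b" "i \<le> a" "b < j" using corner_below[OF j(1)] by blast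
  have "a = i"
  proof (rule ccontr)
    assume "a \<noteq> i"
    then have "(Suc i, j) \<in> P"
      using up_sets_up[OF P, of a "Suc b" "Suc i" j] ab up_sets_bounds[OF P j(1)]
      by (auto simp: corner_def)
    then show False using j by simp
  qed
  then show "i \<in> corner_rows P" using ab by (auto simp: corner_rows_def)
qed (auto simp: corner_rows_def corner_def)

lemma col_step_iff: "(\<exists>i. (i, Suc j) \<in> P \<and> (i, j) \<notin> P) \<longleftrightarrow> j \<in> corner_cols P"
proof
  assume "\<exists>i. (i, Suc j) \<in> P \<and> (i, j) \<notin> P"
  then obtain i where i: "(i, Suc j) \<in> P" "(i, j) \<notin> P" by blast
  obtain a b where ab: "corner P a b" "i \<le> a" "b < Suc j" using corner_below[OF i(1)] by blast
  have "b = j"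
  proof (rule ccontr)
    assume "b \<noteq> j"
    then have "(i, j) \<in> P"
      using up_sets_up[OF P, of a "Suc b" i j] ab up_sets_bounds[OF P i(1)]
      by (auto simp: corner_def)
    then show False using i by simp
  qed
  then show "j \<in> corner_cols P" using ab by (auto simp: corner_cols_def)
qed (auto simp: corner_cols_def corner_def)

end

text \<open>
  The rank function \<open>x \<mapsto> card (S \<inter> {..<x})\<close> is strictly increasing on \<open>S\<close> with values below \<open>card S\<close>,
  hence onto \<open>{..<card S}\<close>.
\<close>

lemma exists_element_of_rank:
  fixes S :: "nat set"
  assumes "finite S" "k < card S"
  shows "\<exists>x\<in>S. card (S \<inter> {..<x}) = k"
proof -
  let ?f = "\<lambda>x. card (S \<inter> {..<x})"
  have less: "?f x < ?f y" if "x \<in> S" "x < y" for x y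
    by (rule psubset_card_mono) (use that assms in force)+
  have inj: "inj_on ?f S"
    by (rule linorder_inj_onI') (use less in \<open>fastforce\<close>)
  have "?f ` S \<subseteq> {..<card S}"
    using assms(1) by (auto intro!: psubset_card_mono)
  then have "?f ` S = {..<card S}"
    by (intro card_subset_eq) (simp_all add: card_image[OF inj])
  then show ?thesis using assms(2) by (metis (no_types, lifting) imageE lessThan_iff)
qed

lemma card_Int_lessThan_Suc:
  fixes S :: "nat set"
  shows "card (S \<inter> {..<Suc x}) = card (S \<inter> {..<x}) + (if x \<in> S then 1 else 0)"
proof -
  have "S \<inter> {..<Suc x} = (if x \<in> S then insert x (S \<inter> {..<x}) else S \<inter> {..<x})"
    by (auto simp: less_Suc_eq)
  then show ?thesis by simp
qed

lemma card_Int_lessThan_mono: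
  fixes S :: "nat set"
  shows "x \<le> y \<Longrightarrow> card (S \<inter> {..<x}) \<le> card (S \<inter> {..<y})"
  by (rule card_mono) auto

context
  fixes l r :: nat and A B :: "nat set"
  assumes AB: "(A, B) \<in> ballot_pairs l 0 r"
begin

lemma ballot_bounds: "A \<subseteq> {1..l}" "B \<subseteq> {1..l}" "finite A" "finite B"
  using AB finite_subset by (auto simp: ballot_pairs_def)

text \<open>
  Membership in the region is monotone by its form. That it stays above the diagonal is the ballot
  condition: below an index \<open>j \<le> i\<close> there are at most as many elements of \<open>B\<close> as of \<open>A\<close>.
\<close>

lemma region_up_set: "region l A B \<in> up_sets l"
proof -
  have lt: "i < j" if "card (A \<inter> {..<i}) < card (B \<inter> {..<j})" for i j
  proof (rule ccontr)
    assume "\<not> i < j"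
    then have "card (A \<inter> {..<j}) \<le> card (A \<inter> {..<i})" by (intro card_Int_lessThan_mono) simp
    moreover have "card (B \<inter> {..<j}) \<le> card (A \<inter> {..<j})"
      using AB by (simp add: ballot_pairs_def)
    ultimately show False using that by simp
  qed
  have up: "card (A \<inter> {..<i'}) < card (B \<inter> {..<j'})"
    if "card (A \<inter> {..<i}) < card (B \<inter> {..<j})" "i' \<le> i" "j \<le> j'" for i j i' j'
    using card_Int_lessThan_mono[OF that(2), of A] card_Int_lessThan_mono[OF that(3), of B] that(1)
    by linarith
  show ?thesis
    unfolding up_sets_def region_def mem_Collect_eq prod.case
    by (intro conjI allI impI) (elim conjE, (assumption | erule lt | erule (2) up))+
qed

text \<open>
  Passing from \<open>i\<close> to \<open>i + 1\<close>, or from \<open>j + 1\<close> to \<open>j\<close>, changes the two counts by at most 1. Each of these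
  moves can break the strict inequality between them only if the difference is exactly 1 and the index
  passed is an element.
\<close>

lemma corner_region_iff:
  "corner (region l A B) i j \<longleftrightarrow> i \<in> A \<and> j \<in> B \<and> card (A \<inter> {..<i}) = card (B \<inter> {..<j})"
proof -
  have "1 \<le> i" if "i \<in> A" using that ballot_bounds by auto
  moreover have "j \<le> l" if "j \<in> B" using that ballot_bounds by auto
  ultimately show ?thesis
    unfolding corner_def region_def by (auto simp: card_Int_lessThan_Suc split: if_splits)
qed

lemma corner_rows_region: "corner_rows (region l A B) = A"
  and corner_cols_region: "corner_cols (region l A B) = B"
proof -
  have eq: "card A = card B" using AB by (simp add: ballot_pairs_def)
  have rank: "card (S \<inter> {..<x}) < card S" if "finite S" "x \<in> S" for S and x :: nat
    by (rule psubset_card_mono) (use that in auto)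
  show "corner_rows (region l A B) = A"
  proof (intro equalityI subsetI)
    fix i assume i: "i \<in> A"
    obtain j where "j \<in> B" "card (B \<inter> {..<j}) = card (A \<inter> {..<i})"
      using exists_element_of_rank[OF ballot_bounds(4)] rank[OF ballot_bounds(3) i] eq by metis
    then show "i \<in> corner_rows (region l A B)"
      using i by (auto simp: corner_rows_def corner_region_iff)
  qed (auto simp: corner_rows_def corner_region_iff)
  show "corner_cols (region l A B) = B"
  proof (intro equalityI subsetI)
    fix j assume j: "j \<in> B"
    obtain i where "i \<in> A" "card (A \<inter> {..<i}) = card (B \<inter> {..<j})"
      using exists_element_of_rank[OF ballot_bounds(3)] rank[OF ballot_bounds(4) j] eq by metis
    then show "j \<in> corner_cols (region l A B)"
      using j by (auto simp: corner_cols_def corner_region_iff)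
  qed (auto simp: corner_cols_def corner_region_iff)
qed

end

lemma bij_betw_corners:
  "bij_betw (\<lambda>P. (corner_rows P, corner_cols P))
     {P \<in> up_sets l. card ({1..l} - (corner_rows P \<union> corner_cols P)) = r} (ballot_pairs l 0 r)"
proof (rule bij_betw_byWitness[where f' = "\<lambda>(A, B). region l A B"])
  let ?U = "{P \<in> up_sets l. card ({1..l} - (corner_rows P \<union> corner_cols P)) = r}"
  have "region l A B \<in> ?U" if AB: "(A, B) \<in> ballot_pairs l 0 r" for A B
    using AB region_up_set[OF AB] corner_rows_region[OF AB] corner_cols_region[OF AB]
    by (simp add: ballot_pairs_def)
  then show "(\<lambda>(A, B). region l A B) ` ballot_pairs l 0 r \<subseteq> ?U"
    by (intro image_subsetI) (simp only: split_paired_all prod.case)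
  have "(corner_rows P, corner_cols P) \<in> ballot_pairs l 0 r" if P: "P \<in> ?U" for P
    using P corner_rows_bound[of P l] corner_cols_bound[of P l] corner_ballot[of P l]
      card_corner_rows_eq_cols[of P l]
    by (simp add: ballot_pairs_def)
  then show "(\<lambda>P. (corner_rows P, corner_cols P)) ` ?U \<subseteq> ballot_pairs l 0 r"
    by blast
  show "\<forall>P\<in>?U. (\<lambda>(A, B). region l A B) (corner_rows P, corner_cols P) = P"
    by (simp add: region_corners)
  show "\<forall>x\<in>ballot_pairs l 0 r. (\<lambda>P. (corner_rows P, corner_cols P)) ((\<lambda>(A, B). region l A B) x) = x"
    using corner_rows_region corner_cols_region by fast
qed

section \<open>Ideals of positive roots as up-sets\<close>

definition root_of :: "nat \<times> nat \<Rightarrow> weight" where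
  "root_of = (\<lambda>(i, j). eps i - eps j)"

lemma root_of_eq_iff:
  assumes "i \<noteq> j"
  shows "root_of (i, j) = root_of (i', j') \<longleftrightarrow> i = i' \<and> j = j'"
proof
  assume "root_of (i, j) = root_of (i', j')"
  then have "\<And>k. root_of (i, j) k = root_of (i', j') k" by simp
  from this[of i] this[of j] show "i = i' \<and> j = j'"
    using assms by (auto simp: root_of_def eps_def split: if_splits)
qed auto

lemma root_of_add:
  "root_of (i, j) + root_of (j, k) = root_of (i, k)"
  "root_of (j, k) + root_of (i, j) = root_of (i, k)"
  by (auto simp: root_of_def)

text \<open>
  The only way in which two roots add up to a root is \<open>(\<epsilon>\<^sub>a - \<epsilon>\<^sub>b) + (\<epsilon>\<^sub>b - \<epsilon>\<^sub>d) = \<epsilon>\<^sub>a - \<epsilon>\<^sub>d\<close>, up to the order of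
  the summands. Otherwise both \<open>a\<close> and \<open>c\<close> are positions with a positive coefficient in the sum
  (a coefficient 2 if they coincide), whereas a root has just one coefficient 1.
\<close>

lemma root_of_add_eq_rootD:
  assumes sum: "root_of (a, b) + root_of (c, d) = root_of (p, q)"
    and ne: "a \<noteq> b" "c \<noteq> d" "p \<noteq> q"
  shows "(b = c \<and> p = a \<and> q = d) \<or> (a = d \<and> p = c \<and> q = b)"
proof -
  consider "b = c" | "a = d" | "b \<noteq> c" "a \<noteq> d" by blast
  then show ?thesis
  proof cases
    case 1
    then show ?thesis
      using sum root_of_add(1)[of a b d] root_of_eq_iff[OF ne(3), of a d] by auto
  next
    case 2
    then show ?thesis
      using sum root_of_add(2)[of a b c] root_of_eq_iff[OF ne(3), of c b] by auto
  next
    case 3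
    have eq: "root_of (a, b) k + root_of (c, d) k = root_of (p, q) k" for k
      using fun_cong[OF sum, of k] by simp
    have "a = p" "a \<noteq> c"
      using eq[of a] 3 ne by (auto simp: root_of_def eps_def split: if_splits)
    moreover have "c = p"
      using eq[of c] 3 ne \<open>a \<noteq> c\<close> by (auto simp: root_of_def eps_def split: if_splits)
    ultimately show ?thesis by simp
  qed
qed

lemma pos_roots_eq: "pos_roots l = root_of ` {(i, j). 1 \<le> i \<and> i < j \<and> j \<le> l + 1}"
  by (auto simp: pos_roots_def root_of_def image_def)

lemma root_of_in_pos_roots_iff:
  "i \<noteq> j \<Longrightarrow> root_of (i, j) \<in> pos_roots l \<longleftrightarrow> 1 \<le> i \<and> i < j \<and> j \<le> l + 1"
  by (auto simp: pos_roots_eq root_of_eq_iff)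

lemma levi_roots_empty: "levi_roots l {} = {}"
proof -
  have nz: "0 \<notin> roots l"
  proof
    assume "0 \<in> roots l"
    then obtain i j where "eps i - eps j = 0" "i \<noteq> j"
      by (auto simp: roots_def)
    then have "(eps i - eps j) i = 0" by simp
    then show False using \<open>i \<noteq> j\<close> by (simp add: eps_def)
  qed
  have "int_span {} = {0}" by (auto simp: int_span_def)
  then show ?thesis using nz by (simp add: levi_roots_def)
qed

lemma int_span_singleton: "int_span {\<alpha>} = range (\<lambda>c k. c * \<alpha> k)"
proof (intro equalityI subsetI)
  fix x assume "x \<in> range (\<lambda>c k. c * \<alpha> k)"
  then obtain c where "x = (\<lambda>k. c * \<alpha> k)" by auto
  then show "x \<in> int_span {\<alpha>}"
    unfolding int_span_def mem_Collect_eq by (intro exI[of _ "\<lambda>_. c"]) simp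
qed (auto simp: int_span_def)

lemma levi_roots_simple:
  assumes "1 \<le> i" "i \<le> l"
  shows "levi_roots l {root_of (i, Suc i)} = {root_of (i, Suc i), root_of (Suc i, i)}"
proof (intro equalityI subsetI)
  fix x assume "x \<in> levi_roots l {root_of (i, Suc i)}"
  then have x: "x \<in> int_span {root_of (i, Suc i)}" "x \<in> roots l"
    by (simp_all add: levi_roots_def)
  obtain c where c: "x = (\<lambda>k. c * root_of (i, Suc i) k)"
    using x(1) by (auto simp: int_span_singleton)
  obtain p q where pq: "x = root_of (p, q)" "p \<noteq> q"
    using x(2) by (auto simp: roots_def root_of_def)
  have eq: "c * root_of (i, Suc i) k = root_of (p, q) k" for k
    using c pq(1) by metis
  from eq[of i] eq[of p] eq[of q] have "(p = i \<and> q = Suc i) \<or> (p = Suc i \<and> q = i)"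
    using pq(2) by (auto simp: root_of_def eps_def split: if_splits)
  then show "x \<in> {root_of (i, Suc i), root_of (Suc i, i)}" using pq by auto
next
  fix x assume x: "x \<in> {root_of (i, Suc i), root_of (Suc i, i)}"
  then have "x = (\<lambda>k. 1 * root_of (i, Suc i) k) \<or> x = (\<lambda>k. (- 1) * root_of (i, Suc i) k)"
    by (auto simp: root_of_def)
  then have "x \<in> int_span {root_of (i, Suc i)}"
    unfolding int_span_singleton by (elim disjE; blast)
  moreover have "x \<in> roots l" using x assms by (fastforce simp: roots_def root_of_def)
  ultimately show "x \<in> levi_roots l {root_of (i, Suc i)}" by (simp add: levi_roots_def)
qed

lemma root_of_mem_image_iff:
  assumes "P \<in> up_sets l" "a \<noteq> b"
  shows "root_of (a, b) \<in> root_of ` P \<longleftrightarrow> (a, b) \<in> P"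
  using assms by (auto simp: root_of_eq_iff)

lemma root_of_image_ad_nilpotent:
  assumes P: "P \<in> up_sets l"
  shows "root_of ` P \<in> ad_nilpotent_sets l {}"
  unfolding ad_nilpotent_sets_def levi_roots_empty
proof (intro CollectI conjI ballI impI)
  show "root_of ` P \<subseteq> pos_roots l - {}"
    using up_sets_bounds[OF P] by (fastforce simp: pos_roots_eq)
  fix x y assume "x \<in> root_of ` P" "y \<in> pos_roots l \<union> {}" and sum: "x + y \<in> pos_roots l"
  then obtain a b c d where x: "x = root_of (a, b)" "(a, b) \<in> P"
    and y: "y = root_of (c, d)" "1 \<le> c" "c < d" "d \<le> l + 1"
    by (auto simp: pos_roots_eq)
  obtain p q where pq: "x + y = root_of (p, q)" "1 \<le> p" "p < q" "q \<le> l + 1"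
    using sum by (auto simp: pos_roots_eq)
  note ab = up_sets_bounds[OF P x(2)]
  have "(b = c \<and> p = a \<and> q = d) \<or> (a = d \<and> p = c \<and> q = b)"
    by (rule root_of_add_eq_rootD) (use pq x y ab in auto)
  then have "(p, q) \<in> P"
    using up_sets_up[OF P x(2), of p q] ab y pq by auto
  then show "x + y \<in> root_of ` P" using pq(1) by simp
qed

text \<open>
  Adding \<open>\<epsilon>\<^bsub>i'\<^esub> - \<epsilon>\<^sub>i\<close> lowers the row and adding \<open>\<epsilon>\<^sub>j - \<epsilon>\<^bsub>j'\<^esub>\<close> raises the column, so closure under addition of
  positive roots is upward closure.
\<close>

lemma ad_nilpotent_sets_eq: "ad_nilpotent_sets l {} = image root_of ` up_sets l"
proof (intro equalityI subsetI)
  fix \<Phi> assume \<Phi>: "\<Phi> \<in> ad_nilpotent_sets l {}"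
  have closed: "x + y \<in> \<Phi>" if "x \<in> \<Phi>" "y \<in> pos_roots l" "x + y \<in> pos_roots l" for x y
    using \<Phi> that by (auto simp: ad_nilpotent_sets_def)
  define P where "P = {(i, j). 1 \<le> i \<and> i < j \<and> j \<le> l + 1 \<and> root_of (i, j) \<in> \<Phi>}"
  have "\<Phi> \<subseteq> pos_roots l" using \<Phi> by (auto simp: ad_nilpotent_sets_def)
  then have "\<Phi> = root_of ` P" by (auto simp: P_def pos_roots_eq)
  moreover have "P \<in> up_sets l"
  proof -
    have up: "(i', j') \<in> P" if "(i, j) \<in> P" "1 \<le> i'" "i' \<le> i" "j \<le> j'" "j' \<le> l + 1" for i j i' j'
    proof -
      have ij: "1 \<le> i" "i < j" "j \<le> l + 1" "root_of (i, j) \<in> \<Phi>" using that by (auto simp: P_def)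
      have row: "root_of (i', j) \<in> \<Phi>"
      proof (cases "i' = i")
        case False
        then show ?thesis
          using closed[of "root_of (i, j)" "root_of (i', i)"] ij that
          by (simp add: root_of_add root_of_in_pos_roots_iff)
      qed (use ij in simp)
      have "root_of (i', j') \<in> \<Phi>"
      proof (cases "j' = j")
        case False
        then show ?thesis
          using closed[OF row, of "root_of (j, j')"] ij that
          by (simp add: root_of_add root_of_in_pos_roots_iff)
      qed (use row in simp)
      then show ?thesis using that ij by (simp add: P_def)
    qed
    have bounds: "\<forall>i j. (i, j) \<in> P \<longrightarrow> 1 \<le> i \<and> i < j \<and> j \<le> l + 1"
      by (simp add: P_def)
    show ?thesis
      unfolding up_sets_def mem_Collect_eq by (intro conjI[OF bounds] allI impI) (rule up)
  qed
  ultimately show "\<Phi> \<in> image root_of ` up_sets l" by blast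
qed (use root_of_image_ad_nilpotent in auto)

lemma inj_on_root_image: "inj_on (image root_of) (up_sets l)"
proof (rule inj_onI)
  fix P Q assume PQ: "P \<in> up_sets l" "Q \<in> up_sets l" and eq: "root_of ` P = root_of ` Q"
  have "(i, j) \<in> P \<longleftrightarrow> (i, j) \<in> Q" for i j
    using root_of_mem_image_iff[OF PQ(1), of i j] root_of_mem_image_iff[OF PQ(2), of i j] eq
      up_sets_bounds[OF PQ(1), of i j] up_sets_bounds[OF PQ(2), of i j] by (cases "i = j") auto
  then show "P = Q" by auto
qed

text \<open>
  The Levi roots of \<open>{\<alpha>\<^sub>i}\<close> are \<open>\<plusminus>\<alpha>\<^sub>i\<close>, so the new requirements are closure under subtraction of \<open>\<alpha>\<^sub>i\<close> and
  \<open>\<alpha>\<^sub>i \<notin> \<Phi>\<close>. They mean that \<open>P\<close> is preserved by the moves from row \<open>i\<close> to row \<open>i + 1\<close> and from column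
  \<open>i + 1\<close> to column \<open>i\<close>. The condition \<open>\<alpha>\<^sub>i \<notin> \<Phi>\<close> is part of this, as either move sends \<open>(i, i + 1)\<close>
  to the diagonal, which is disjoint from \<open>P\<close>.
\<close>

lemma root_of_image_ad_nilpotent_simple_iff:
  assumes P: "P \<in> up_sets l" and i: "1 \<le> i" "i \<le> l"
  shows "root_of ` P \<in> ad_nilpotent_sets l {root_of (i, Suc i)} \<longleftrightarrow>
    i \<notin> corner_rows P \<and> i \<notin> corner_cols P"
proof -
  note mem = root_of_mem_image_iff[OF P]
  note bounds = up_sets_bounds[OF P]
  show ?thesis
  proof
    assume "root_of ` P \<in> ad_nilpotent_sets l {root_of (i, Suc i)}"
    then have disj: "root_of (i, Suc i) \<notin> root_of ` P"
      and closed: "\<And>x. x \<in> root_of ` P \<Longrightarrow> x + root_of (Suc i, i) \<in> pos_roots l \<Longrightarrow>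
        x + root_of (Suc i, i) \<in> root_of ` P"
      unfolding ad_nilpotent_sets_def levi_roots_simple[OF i] by auto
    have no: "(i, Suc i) \<notin> P" using disj by auto
    have "(Suc i, j) \<in> P" if ij: "(i, j) \<in> P" for j
    proof -
      have "Suc i < j" using bounds[OF ij] no ij by (cases "j = Suc i") auto
      then show ?thesis
        using closed[of "root_of (i, j)"] ij bounds[OF ij] mem[of "Suc i" j]
        by (simp add: root_of_add root_of_in_pos_roots_iff)
    qed
    moreover have "(k, i) \<in> P" if ki: "(k, Suc i) \<in> P" for k
    proof -
      have "k < i" using bounds[OF ki] no ki by (cases "k = i") auto
      then show ?thesis
        using closed[of "root_of (k, Suc i)"] ki bounds[OF ki] mem[of k i]
        by (simp add: root_of_add root_of_in_pos_roots_iff)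
    qed
    ultimately show "i \<notin> corner_rows P \<and> i \<notin> corner_cols P"
      unfolding row_step_iff[OF P, symmetric] col_step_iff[OF P, symmetric] by blast
  next
    assume "i \<notin> corner_rows P \<and> i \<notin> corner_cols P"
    then have row: "\<And>j. (i, j) \<in> P \<Longrightarrow> (Suc i, j) \<in> P"
      and col: "\<And>k. (k, Suc i) \<in> P \<Longrightarrow> (k, i) \<in> P"
      unfolding row_step_iff[OF P, symmetric] col_step_iff[OF P, symmetric] by blast+
    have ad: "root_of ` P \<in> ad_nilpotent_sets l {}" by (rule root_of_image_ad_nilpotent[OF P])
    show "root_of ` P \<in> ad_nilpotent_sets l {root_of (i, Suc i)}"
      unfolding ad_nilpotent_sets_def levi_roots_simple[OF i]
    proof (intro CollectI conjI ballI impI)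
      have "(i, Suc i) \<notin> P" using row[of "Suc i"] bounds[of "Suc i" "Suc i"] by auto
      moreover have "(Suc i, i) \<notin> P" using bounds[of "Suc i" i] by auto
      ultimately have "root_of (i, Suc i) \<notin> root_of ` P" "root_of (Suc i, i) \<notin> root_of ` P"
        using mem[of i "Suc i"] mem[of "Suc i" i] by simp_all
      moreover have "root_of ` P \<subseteq> pos_roots l"
        using ad unfolding ad_nilpotent_sets_def by blast
      ultimately show "root_of ` P \<subseteq> pos_roots l - {root_of (i, Suc i), root_of (Suc i, i)}"
        by blast
      fix x y assume x: "x \<in> root_of ` P"
        and y: "y \<in> pos_roots l \<union> {root_of (i, Suc i), root_of (Suc i, i)}"
        and sum: "x + y \<in> pos_roots l"
      show "x + y \<in> root_of ` P"
      proof (cases "y = root_of (Suc i, i)")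
        case False
        then have "y \<in> pos_roots l" using y i by (auto simp: root_of_in_pos_roots_iff)
        then show ?thesis using ad x sum by (auto simp: ad_nilpotent_sets_def)
      next
        case True
        obtain a b where ab: "x = root_of (a, b)" "(a, b) \<in> P" using x by auto
        obtain p q where pq: "x + y = root_of (p, q)" "1 \<le> p" "p < q" "q \<le> l + 1"
          using sum by (auto simp: pos_roots_eq)
        have "(b = Suc i \<and> p = a \<and> q = i) \<or> (a = i \<and> p = Suc i \<and> q = b)"
          by (rule root_of_add_eq_rootD) (use pq ab True bounds[OF ab(2)] in auto)
        then have "(p, q) \<in> P" using row[of b] col[of a] ab(2) by auto
        then show ?thesis using pq(1) by simp
      qed
    qed
  qed
qed

lemma card_max_parabolic:
  assumes P: "P \<in> up_sets l"
  shows "card (max_parabolic l (root_of ` P)) = card ({1..l} - (corner_rows P \<union> corner_cols P))"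
proof -
  have simple: "simple_roots l = (\<lambda>i. root_of (i, Suc i)) ` {1..l}"
    by (auto simp: simple_roots_def root_of_def)
  have "max_parabolic l (root_of ` P) =
      (\<lambda>i. root_of (i, Suc i)) ` ({1..l} - (corner_rows P \<union> corner_cols P))"
    unfolding max_parabolic_def simple
    using root_of_image_ad_nilpotent_simple_iff[OF P] by auto
  moreover have "inj_on (\<lambda>i. root_of (i, Suc i)) X" for X
    by (rule inj_onI) (simp add: root_of_eq_iff)
  ultimately show ?thesis by (simp add: card_image)
qed

theorem corollary5p4:
  fixes l r :: nat
  assumes "l \<ge> 1" and "r \<le> l"
  shows "real (card {\<Phi> \<in> ad_nilpotent_sets l {}. card (max_parabolic l \<Phi>) = r}) =
         real (l choose r) *
           (\<Sum>k = 0..(l - r) div 2. real ((l - r) choose (2 * k)) * catalan k)"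
proof -
  let ?U = "{P \<in> up_sets l. card ({1..l} - (corner_rows P \<union> corner_cols P)) = r}"
  have "{\<Phi> \<in> ad_nilpotent_sets l {}. card (max_parabolic l \<Phi>) = r} = image root_of ` ?U"
    by (auto simp: ad_nilpotent_sets_eq card_max_parabolic)
  also have "card \<dots> = card ?U"
    by (rule card_image) (rule inj_on_subset[OF inj_on_root_image], auto)
  also have "\<dots> = card (ballot_pairs l 0 r)"
    by (rule bij_betw_same_card[OF bij_betw_corners])
  finally show ?thesis
    by (simp add: card_ballot_pairs motzkin_eq_sum_catalan)
qed

end
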